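(* There exists a choice rule $R$ such that, for certain $A\in\mathbb{R}^{m\times N}$ and $f\in\mathbb{R}^m$, the meta approach (described in the context) combined with $R$ yields a piecewise linear and continuous solution path $t\mapsto u(t)$ with infinitely many kinks.
   Context: For $t>0$, $U_t:=\operatorname{argmin}_{u\in\mathbb{R}^N}\frac12\|Au-f\|_2^2+t\|u\|_1$ (the set of minimizers), and $U_0:=\operatorname{argmin}\{\|u\|_1: u\in\mathbb{R}^N,\ A^T(Au-f)=0\}$. A solution path is a function $u\colon\mathbb{R}_{\ge0}\to\mathbb{R}^N$ with $u(t)\in U_t$ for all $t>0$ and $u(0)\in U_0$. For $\hat t>0$ and $u(\hat t)\in U_{\hat t}$, the set of all possible directions is $$\mathcal{D}(\hat t,u(\hat t))=\{d\in\mathbb{R}^N:\ \exists\,\delta\in(0,\hat t]\ \text{such that}\ u(\hat t)+(\hat t-t)d\in U_t\ \ \forall t\in[\hat t-\delta,\hat t]\}.$$ A choice rule $R$ is a rule assigning to each set $\mathcal{D}$ of possible directions an element $R(\mathcal{D})\in\mathcal{D}$; the choice depends only on the set $\mathcal{D}$. Meta approach with choice rule $R$: start with $t^0=\|A^Tf\|_\infty$ and $u(t^0)=0$ (and $u(t)=0$ for $t\ge t^0$). For $j=0,1,2,\dots$, as long as $t^j>0$, take the direction $d^{j+1}=R(\mathcal{D}(t^j,u(t^j)))$ and follow $u(t)=u(t^j)+(t^j-t)d^{j+1}$ for decreasing $t$ as long as $u(t)\in U_t$, i.e. down to the minimal $t^{j+1}\ge0$ such that $u(t)\in U_t$ for all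 $t\in[t^{j+1},t^j]$; then repeat from $(t^{j+1},u(t^{j+1}))$. The resulting path is affine on each $[t^{j+1},t^j]$; here "piecewise linear" allows infinitely many pieces, and if there are infinitely many steps with $t^j\to0$ the value $u(0)$ is obtained by continuity. A kink is a parameter at which the direction of the path changes. *)

theory Defs
  imports Complex_Main "Jordan_Normal_Form.Matrix"
begin

text \<open>Vectors and matrices are those of Jordan_Normal_Form, so that one choice rule can serve all
  dimensions at once. Paths are total functions on the reals; only their values at nonnegative
  parameters matter.\<close>

definition l1_norm :: "real vec \<Rightarrow> real" where
  "l1_norm v = (\<Sum>i<dim_vec v. \<bar>v $ i\<bar>)"

definition l2_norm :: "real vec \<Rightarrow> real" where
  "l2_norm v = sqrt (\<Sum>i<dim_vec v. (v $ i)\<^sup>2)"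

text \<open>Inserting 0 only matters for the vector of dimension 0.\<close>

definition linf_norm :: "real vec \<Rightarrow> real" where
  "linf_norm v = Max (insert 0 ((\<lambda>i. \<bar>v $ i\<bar>) ` {..<dim_vec v}))"

definition solutions :: "real mat \<Rightarrow> real vec \<Rightarrow> real \<Rightarrow> real vec set" where
  "solutions A f t =
     (if t > 0
      then {u. is_arg_min (\<lambda>u. 1/2 * (l2_norm (A *\<^sub>v u - f))\<^sup>2 + t * l1_norm u)
                 (\<lambda>u. u \<in> carrier_vec (dim_col A)) u}
      else {u. is_arg_min l1_norm
                 (\<lambda>u. u \<in> carrier_vec (dim_col A) \<and>
                      transpose_mat A *\<^sub>v (A *\<^sub>v u - f) = 0\<^sub>v (dim_col A)) u})"

definition solution_path :: "real mat \<Rightarrow> real vec \<Rightarrow> (real \<Rightarrow> real vec) \<Rightarrow> bool" where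
  "solution_path A f u \<longleftrightarrow> (\<forall>t\<ge>0. u t \<in> solutions A f t)"

definition directions :: "real mat \<Rightarrow> real vec \<Rightarrow> real \<Rightarrow> real vec \<Rightarrow> real vec set" where
  "directions A f s x =
     {d \<in> carrier_vec (dim_col A).
        \<exists>\<delta>. 0 < \<delta> \<and> \<delta> \<le> s \<and> (\<forall>t\<in>{s - \<delta>..s}. x + (s - t) \<cdot>\<^sub>v d \<in> solutions A f t)}"

definition choice_rule :: "(real vec set \<Rightarrow> real vec) \<Rightarrow> bool" where
  "choice_rule R \<longleftrightarrow>
     (\<forall>m N A f t x. A \<in> carrier_mat m N \<longrightarrow> f \<in> carrier_vec m \<longrightarrow> t > 0 \<longrightarrow> x \<in> solutions A f t \<longrightarrow>
        R (directions A f t x) \<in> directions A f t x)"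

text \<open>One step of the meta approach from parameter \<open>s\<close> down to \<open>s'\<close>.\<close>

definition meta_step ::
  "real mat \<Rightarrow> real vec \<Rightarrow> (real vec set \<Rightarrow> real vec) \<Rightarrow> real \<Rightarrow> real \<Rightarrow> (real \<Rightarrow> real vec) \<Rightarrow> bool" where
  "meta_step A f R s s' u \<longleftrightarrow>
     (let d = R (directions A f s (u s));
          follow = (\<lambda>t. u s + (s - t) \<cdot>\<^sub>v d);
          S = {r. 0 \<le> r \<and> r \<le> s \<and> (\<forall>t\<in>{r..s}. follow t \<in> solutions A f t)}
      in s' \<in> S \<and> (\<forall>r\<in>S. s' \<le> r) \<and> (\<forall>t\<in>{s'..s}. u t = follow t))"

text \<open>\<open>b j\<close> is the parameter reached after \<open>j\<close> steps; it stays constant once it has reached 0.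
  Convergence of \<open>b\<close> to 0 expresses that the steps reach every positive parameter, so that the
  run determines a path on all of the nonnegative reals. The limit condition gives the value at 0
  in the case of infinitely many steps and follows from the other conditions otherwise.\<close>

definition meta_path ::
  "real mat \<Rightarrow> real vec \<Rightarrow> (real vec set \<Rightarrow> real vec) \<Rightarrow> (real \<Rightarrow> real vec) \<Rightarrow> bool" where
  "meta_path A f R u \<longleftrightarrow>
     (\<exists>b :: nat \<Rightarrow> real.
        b 0 = linf_norm (transpose_mat A *\<^sub>v f) \<and>
        (\<forall>t\<ge>b 0. u t = 0\<^sub>v (dim_col A)) \<and>
        (\<forall>j. if b j > 0 then meta_step A f R (b j) (b (Suc j)) u else b (Suc j) = b j) \<and>
        b \<longlonglongrightarrow> 0 \<and>
        u 0 \<in> carrier_vec (dim_col A) \<and>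
        (\<forall>i<dim_col A. ((\<lambda>t. u t $ i) \<longlongrightarrow> u 0 $ i) (at_right 0)))"

definition continuous_path :: "nat \<Rightarrow> (real \<Rightarrow> real vec) \<Rightarrow> bool" where
  "continuous_path N u \<longleftrightarrow>
     (\<forall>t\<ge>0. u t \<in> carrier_vec N) \<and> (\<forall>i<N. continuous_on {0..} (\<lambda>t. u t $ i))"

definition affine_path_on :: "nat \<Rightarrow> real set \<Rightarrow> (real \<Rightarrow> real vec) \<Rightarrow> bool" where
  "affine_path_on N S u \<longleftrightarrow>
     (\<exists>c\<in>carrier_vec N. \<exists>d\<in>carrier_vec N. \<forall>t\<in>S. u t = c + t \<cdot>\<^sub>v d)"

text \<open>Infinitely many pieces are allowed, but they may accumulate only at 0.\<close>

definition piecewise_linear :: "nat \<Rightarrow> (real \<Rightarrow> real vec) \<Rightarrow> bool" where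
  "piecewise_linear N u \<longleftrightarrow>
     (\<exists>b :: nat \<Rightarrow> real. decseq b \<and> b \<longlonglongrightarrow> 0 \<and>
        affine_path_on N {b 0..} u \<and> (\<forall>j. affine_path_on N {b (Suc j)..b j} u))"

text \<open>The path runs with direction \<open>d\<close> just above \<open>t\<close> and with direction \<open>d'\<close> just below \<open>t\<close>;
  directions are taken with respect to decreasing parameters, as in \<open>directions\<close>.\<close>

definition kink :: "nat \<Rightarrow> (real \<Rightarrow> real vec) \<Rightarrow> real \<Rightarrow> bool" where
  "kink N u t \<longleftrightarrow>
     (\<exists>d\<in>carrier_vec N. \<exists>d'\<in>carrier_vec N. \<exists>\<delta>. d \<noteq> d' \<and> 0 < \<delta> \<and> \<delta> \<le> t \<and>
        (\<forall>s\<in>{t..t + \<delta>}. u s = u t + (t - s) \<cdot>\<^sub>v d) \<and>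
        (\<forall>s\<in>{t - \<delta>..t}. u s = u t + (t - s) \<cdot>\<^sub>v d'))"

end

theory Submission
  imports Defs
begin

text \<open>By the optimality conditions, the possible directions at a solution are the minimisers of a
  least squares problem with sign constraints on some coordinates; such a problem is always solvable,
  hence choice rules exist. For
  \<open>A = ((1, 1, 1, 0), (0, 0, 0, 1))\<close> and \<open>f = (3, 1)\<close>, the solutions at \<open>t\<close> are the nonnegative
  \<open>u\<close> with \<open>u\<^sub>0 + u\<^sub>1 + u\<^sub>2 = max 0 (3 - t)\<close> and \<open>u\<^sub>3 = max 0 (1 - t)\<close>. The possible directions depend
  only on which of \<open>u\<^sub>0\<close>, \<open>u\<^sub>1\<close>, \<open>u\<^sub>2\<close> vanish and on whether \<open>t \<le> 1\<close>. For \<open>t \<le> 1\<close> the rule moves along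
  \<open>(1, -2, 2, 1)\<close> on the face \<open>u\<^sub>0 = 0\<close> and along \<open>(-2, 1, 2, 1)\<close> on the face \<open>u\<^sub>1 = 0\<close>, so that the path
  bounces between the two faces with \<open>u\<^sub>0 + u\<^sub>1 = t\<close> and halves \<open>t\<close> at each bounce. The fourth
  coordinate serves as a clock: it changes the set of directions at \<open>t = 1\<close>, where the bouncing
  has to start in order to end exactly at \<open>t = 0\<close>.\<close>

subsection \<open>Least squares with sign constraints\<close>

text \<open>Gram-Schmidt by induction on \<open>J\<close>; linear dependence is allowed. The
  induction hypothesis serves two targets: \<open>a j\<close>, to split off its part
  \<open>w\<close> orthogonal to the earlier vectors, and \<open>c\<close> itself. Moving along
  \<open>w\<close> keeps orthogonality to the earlier vectors intact.\<close>

lemma normal_equations: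
  fixes a :: "'i \<Rightarrow> 'k \<Rightarrow> real"
  assumes "finite M" "finite J"
  shows "\<exists>z. \<forall>j\<in>J. (\<Sum>k\<in>M. a j k * (c k - (\<Sum>i\<in>J. z i * a i k))) = 0"
  using assms(2)
proof (induction J arbitrary: c)
  case empty
  then show ?case by simp
next
  case (insert j J)
  obtain \<alpha> where \<alpha>: "\<forall>i\<in>J. (\<Sum>k\<in>M. a i k * (a j k - (\<Sum>l\<in>J. \<alpha> l * a l k))) = 0"
    using insert.IH by blast
  obtain z where z: "\<forall>i\<in>J. (\<Sum>k\<in>M. a i k * (c k - (\<Sum>l\<in>J. z l * a l k))) = 0"
    using insert.IH by blast
  define w where "w k = a j k - (\<Sum>l\<in>J. \<alpha> l * a l k)" for k
  define r where "r k = c k - (\<Sum>l\<in>J. z l * a l k)" for k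
  \<comment> \<open>The projection coefficient of \<open>r\<close> on \<open>w\<close>. If
    \<open>w\<close> vanishes on \<open>M\<close>, division by zero gives \<open>0\<close>, and any
    value would do.\<close>
  define \<theta> where "\<theta> = (\<Sum>k\<in>M. w k * r k) / (\<Sum>k\<in>M. w k * w k)"
  define z' where "z' i = (if i = j then \<theta> else z i - \<theta> * \<alpha> i)" for i
  have res: "c k - (\<Sum>i\<in>insert j J. z' i * a i k) = r k - \<theta> * w k" for k
  proof -
    have "(\<Sum>i\<in>J. z' i * a i k) = (\<Sum>i\<in>J. (z i - \<theta> * \<alpha> i) * a i k)"
      using insert.hyps by (intro sum.cong) (auto simp: z'_def)
    also have "\<dots> = (\<Sum>i\<in>J. z i * a i k) - \<theta> * (\<Sum>i\<in>J. \<alpha> i * a i k)"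
      by (simp add: algebra_simps sum_subtractf sum_distrib_left)
    finally show ?thesis
      using insert.hyps by (simp add: z'_def r_def w_def algebra_simps)
  qed
  have orth: "(\<Sum>k\<in>M. a i k * (r k - \<theta> * w k)) = 0" if "i \<in> J" for i
  proof -
    have "(\<Sum>k\<in>M. a i k * (r k - \<theta> * w k)) = (\<Sum>k\<in>M. a i k * r k) - \<theta> * (\<Sum>k\<in>M. a i k * w k)"
      by (simp add: algebra_simps sum_subtractf sum_distrib_left)
    then show ?thesis using that \<alpha> z by (simp add: r_def w_def)
  qed
  have "(\<Sum>k\<in>M. w k * r k) - \<theta> * (\<Sum>k\<in>M. w k * w k) = 0"
  proof (cases "(\<Sum>k\<in>M. w k * w k) = 0")
    case True
    then have "\<forall>k\<in>M. w k = 0"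
      using assms(1) by (subst (asm) sum_nonneg_eq_0_iff) auto
    then show ?thesis by simp
  qed (simp add: \<theta>_def)
  then have w0: "(\<Sum>k\<in>M. w k * (r k - \<theta> * w k)) = 0"
    by (simp add: algebra_simps sum_subtractf sum_distrib_left)
  \<comment> \<open>\<open>a j\<close> is \<open>w\<close> plus a combination of the earlier
    vectors, so orthogonality to all of these gives orthogonality to \<open>a j\<close>.\<close>
  have "a j k * (r k - \<theta> * w k)
      = w k * (r k - \<theta> * w k) + (\<Sum>l\<in>J. \<alpha> l * (a l k * (r k - \<theta> * w k)))" for k
  proof -
    have "a j k = w k + (\<Sum>l\<in>J. \<alpha> l * a l k)" by (simp add: w_def)
    then have "a j k * q = w k * q + (\<Sum>l\<in>J. \<alpha> l * (a l k * q))" for q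
      by (simp add: distrib_right sum_distrib_right mult.assoc)
    then show ?thesis .
  qed
  then have "(\<Sum>k\<in>M. a j k * (r k - \<theta> * w k))
      = (\<Sum>k\<in>M. w k * (r k - \<theta> * w k)) + (\<Sum>k\<in>M. \<Sum>l\<in>J. \<alpha> l * (a l k * (r k - \<theta> * w k)))"
    by (simp only: sum.distrib)
  also have "\<dots> = (\<Sum>l\<in>J. \<alpha> l * (\<Sum>k\<in>M. a l k * (r k - \<theta> * w k)))"
    unfolding w0 by (subst sum.swap) (simp add: sum_distrib_left)
  also have "\<dots> = 0" using orth by simp
  finally show ?case
    using orth by (intro exI[of _ z']) (auto simp only: res insert_iff)
qed

text \<open>Induction on the set of constrained indices. If the solution with \<open>p\<close> unconstrained has a negative
  coefficient at \<open>p\<close>, then the solution without the \<open>p\<close>-th vector also satisfies the condition at \<open>p\<close>: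
  expanding the squared distance of the two residuals, all terms but the one for \<open>p\<close> are nonpositive.\<close>

lemma sign_constrained_least_squares:
  fixes a :: "'i \<Rightarrow> 'k \<Rightarrow> real"
  assumes "finite M" "finite J" "P \<subseteq> J"
  obtains y where "\<And>i. i \<in> P \<Longrightarrow> 0 \<le> y i"
    and "\<And>i. i \<in> J - P \<Longrightarrow> (\<Sum>k\<in>M. a i k * (c k - (\<Sum>l\<in>J. y l * a l k))) = 0"
    and "\<And>i. i \<in> P \<Longrightarrow> (\<Sum>k\<in>M. a i k * (c k - (\<Sum>l\<in>J. y l * a l k))) \<le> 0"
    and "\<And>i. i \<in> P \<Longrightarrow> y i * (\<Sum>k\<in>M. a i k * (c k - (\<Sum>l\<in>J. y l * a l k))) = 0"
proof -
  \<comment> \<open>The negative gradient of half the squared residual with respect to the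
    \<open>i\<close>-th coefficient; the claim below is the KKT system of the constrained
    problem.\<close>
  define \<gamma> where "\<gamma> J y i = (\<Sum>k\<in>M. a i k * (c k - (\<Sum>l\<in>J. y l * a l k)))" for J y i
  have "finite P" using assms finite_subset by blast
  then have "\<exists>y. (\<forall>i\<in>P. 0 \<le> y i) \<and> (\<forall>i\<in>J - P. \<gamma> J y i = 0) \<and> (\<forall>i\<in>P. \<gamma> J y i \<le> 0 \<and> y i * \<gamma> J y i = 0)"
    using assms(2,3)
  proof (induction P arbitrary: J)
    case empty
    then show ?case using normal_equations[OF assms(1), of J a c] by (auto simp: \<gamma>_def)
  next
    case (insert p P)
    obtain y where y: "\<forall>i\<in>P. 0 \<le> y i" "\<forall>i\<in>J - P. \<gamma> J y i = 0"
      "\<forall>i\<in>P. \<gamma> J y i \<le> 0 \<and> y i * \<gamma> J y i = 0"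
      using insert.IH[of J] insert.prems by auto
    show ?case
    proof (cases "0 \<le> y p")
      case True
      \<comment> \<open>So far \<open>p\<close> was unconstrained, so
        \<open>\<gamma> J y p = 0\<close> and both new conditions at \<open>p\<close> hold.\<close>
      then show ?thesis using y insert.prems insert.hyps by (intro exI[of _ y]) auto
    next
      case False
      define K where "K = J - {p}"
      have K: "finite K" "p \<notin> K" "J = insert p K" "P \<subseteq> K"
        using insert.prems insert.hyps by (auto simp: K_def)
      obtain y' where y': "\<forall>i\<in>P. 0 \<le> y' i" "\<forall>i\<in>K - P. \<gamma> K y' i = 0"
        "\<forall>i\<in>P. \<gamma> K y' i \<le> 0 \<and> y' i * \<gamma> K y' i = 0"
        using insert.IH[of K] K by auto
      \<comment> \<open>Padding with \<open>0\<close> keeps the residual, hence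
        \<open>\<gamma>\<close>, so the solution over \<open>K\<close> can be compared with
        \<open>y\<close> over the common index set \<open>J\<close>.\<close>
      define z where "z = y'(p := 0)"
      have sum_z: "(\<Sum>l\<in>J. z l * a l k) = (\<Sum>l\<in>K. y' l * a l k)" for k
      proof -
        have "(\<Sum>l\<in>K. z l * a l k) = (\<Sum>l\<in>K. y' l * a l k)"
          using K by (intro sum.cong) (auto simp: z_def)
        then show ?thesis using K by (simp add: z_def)
      qed
      have \<gamma>z: "\<gamma> J z i = \<gamma> K y' i" for i
        unfolding \<gamma>_def sum_z ..
      define e where "e k = (\<Sum>l\<in>J. (y l - z l) * a l k)" for k
      have diff: "(\<Sum>k\<in>M. a i k * e k) = \<gamma> J z i - \<gamma> J y i" for i
        by (simp add: \<gamma>_def e_def algebra_simps sum_subtractf)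
      have "0 \<le> (\<Sum>k\<in>M. e k * e k)" by (simp add: sum_nonneg)
      also have "\<dots> = (\<Sum>k\<in>M. \<Sum>l\<in>J. (y l - z l) * (a l k * e k))"
        by (intro sum.cong refl) (subst (1) e_def, simp add: sum_distrib_right mult.assoc)
      also have "\<dots> = (\<Sum>l\<in>J. (y l - z l) * (\<gamma> J z l - \<gamma> J y l))"
        by (subst sum.swap) (simp add: sum_distrib_left[symmetric] diff)
      also have "\<dots> = y p * \<gamma> J z p + (\<Sum>l\<in>K. (y l - z l) * (\<gamma> J z l - \<gamma> J y l))"
        using K y(2) insert.hyps by (simp add: z_def)
      also have "\<dots> \<le> y p * \<gamma> J z p + 0"
      proof (intro add_left_mono sum_nonpos)
        fix l assume l: "l \<in> K"
        show "(y l - z l) * (\<gamma> J z l - \<gamma> J y l) \<le> 0"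
        proof (cases "l \<in> P")
          case True
          then have "z l = y' l" using insert.hyps by (auto simp: z_def)
          \<comment> \<open>Of the four products in the expansion two vanish by complementarity; the
            mixed ones pair a nonnegative coefficient with a nonpositive
            \<open>\<gamma>\<close>.\<close>
          moreover have "y l * \<gamma> J z l \<le> 0" "y' l * \<gamma> J y l \<le> 0"
            using True y y' by (auto simp: \<gamma>z intro: mult_nonneg_nonpos)
          moreover have "y l * \<gamma> J y l = 0" "y' l * \<gamma> J z l = 0"
            using True y y' by (auto simp: \<gamma>z)
          ultimately show ?thesis by (simp add: algebra_simps del: mult_eq_0_iff)
        next
          case False
          then have "\<gamma> J y l = 0" "\<gamma> J z l = 0"
            using l False K(3) y(2) y'(2) unfolding \<gamma>z by auto
          then show ?thesis by simp
        qed
      qed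
      finally have "\<gamma> J z p \<le> 0"
        using False by (simp add: zero_le_mult_iff)
      moreover have "z p = 0" "\<forall>i\<in>P. z i = y' i"
        using insert.hyps by (auto simp: z_def)
      moreover have "J - insert p P = K - P" by (auto simp: K_def)
      ultimately show ?thesis
        using y' by (intro exI[of _ z]) (simp add: \<gamma>z)
    qed
  qed
  then show ?thesis using that unfolding \<gamma>_def by blast
qed

subsection \<open>Optimality conditions and possible directions\<close>

text \<open>The entries of \<open>A\<^sup>T (f - A u)\<close>, the negative gradient of the
  quadratic term at \<open>u\<close>.\<close>

definition correlation :: "real mat \<Rightarrow> real vec \<Rightarrow> real vec \<Rightarrow> nat \<Rightarrow> real" where
  "correlation A f u i = (\<Sum>k<dim_row A. A $$ (k, i) * (f $ k - (A *\<^sub>v u) $ k))"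

lemma mult_mat_vec_nth:
  assumes "A \<in> carrier_mat m N" "u \<in> carrier_vec N" "k < m"
  shows "(A *\<^sub>v u) $ k = (\<Sum>i<N. A $$ (k, i) * u $ i)"
  using assms by (auto simp: scalar_prod_def atLeast0LessThan intro!: sum.cong)

lemma l2_norm_square: "(l2_norm v)\<^sup>2 = (\<Sum>i<dim_vec v. (v $ i)\<^sup>2)"
  by (simp add: l2_norm_def sum_nonneg)

text \<open>The second-order Taylor expansion, exact because the term is quadratic. Its remainder is
  a sum of squares, so first-order conditions will also be sufficient.\<close>

lemma residual_expansion:
  assumes A: "A \<in> carrier_mat m N" and f: "f \<in> carrier_vec m"
    and u: "u \<in> carrier_vec N" and v: "v \<in> carrier_vec N"
  shows "1/2 * (l2_norm (A *\<^sub>v v - f))\<^sup>2 = 1/2 * (l2_norm (A *\<^sub>v u - f))\<^sup>2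
      - (\<Sum>i<N. correlation A f u i * (v $ i - u $ i))
      + 1/2 * (\<Sum>k<m. (\<Sum>i<N. A $$ (k, i) * (v $ i - u $ i))\<^sup>2)"
proof -
  define r where "r k = f $ k - (A *\<^sub>v u) $ k" for k
  define e where "e k = (\<Sum>i<N. A $$ (k, i) * (v $ i - u $ i))" for k
  have sq: "(l2_norm (A *\<^sub>v w - f))\<^sup>2 = (\<Sum>k<m. ((A *\<^sub>v w) $ k - f $ k)\<^sup>2)" for w
    using A f by (simp add: l2_norm_square)
  have v_res: "(A *\<^sub>v v) $ k - f $ k = e k - r k" if "k < m" for k
    unfolding e_def r_def mult_mat_vec_nth[OF A u that] mult_mat_vec_nth[OF A v that]
    by (simp add: algebra_simps sum_subtractf)
  have "(\<Sum>k<m. ((A *\<^sub>v v) $ k - f $ k)\<^sup>2) = (\<Sum>k<m. (r k)\<^sup>2 - 2 * (r k * e k) + (e k)\<^sup>2)"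
    by (intro sum.cong) (auto simp: v_res power2_eq_square algebra_simps)
  also have "\<dots> = (\<Sum>k<m. (r k)\<^sup>2) - 2 * (\<Sum>k<m. r k * e k) + (\<Sum>k<m. (e k)\<^sup>2)"
    by (simp add: sum.distrib sum_subtractf sum_distrib_left)
  finally have 1: "(l2_norm (A *\<^sub>v v - f))\<^sup>2
      = (l2_norm (A *\<^sub>v u - f))\<^sup>2 - 2 * (\<Sum>k<m. r k * e k) + (\<Sum>k<m. (e k)\<^sup>2)"
    by (simp add: sq r_def power2_commute)
  have "(\<Sum>k<m. r k * e k) = (\<Sum>k<m. \<Sum>i<N. A $$ (k, i) * r k * (v $ i - u $ i))"
    by (simp add: e_def sum_distrib_left mult_ac)
  also have "\<dots> = (\<Sum>i<N. correlation A f u i * (v $ i - u $ i))"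
    using A by (subst sum.swap) (simp add: correlation_def r_def sum_distrib_right)
  finally show ?thesis using 1 by (simp add: e_def)
qed

text \<open>Shrinking a step by a factor \<open>\<mu>\<close> shrinks the linear term by
  \<open>\<mu>\<close>, the quadratic one by \<open>\<mu>\<close> squared, and by convexity the
  increase of the absolute value at least in proportion. Hence the inequality survives without the
  quadratic term, and a few test points give the claim.\<close>

lemma soft_threshold_optimality:
  fixes g q s x :: real
  assumes "0 < s" and min: "\<And>y. 0 \<le> - (g * (y - x)) + q * (y - x)\<^sup>2 + s * (\<bar>y\<bar> - \<bar>x\<bar>)"
  shows "\<bar>g\<bar> \<le> s" and "g * x = s * \<bar>x\<bar>"
proof -
  have sub: "g * (y - x) \<le> s * (\<bar>y\<bar> - \<bar>x\<bar>)" for y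
  proof (rule ccontr)
    define e where "e = g * (y - x) - s * (\<bar>y\<bar> - \<bar>x\<bar>)"
    define Q where "Q = \<bar>q * (y - x)\<^sup>2\<bar>"
    \<comment> \<open>At most 1 for the convexity estimate, and small enough that
      \<open>\<mu> * Q\<close> stays below the assumed violation \<open>e\<close>.\<close>
    define \<mu> where "\<mu> = min 1 (e / (2 * Q + 1))"
    assume "\<not> ?thesis"
    then have "0 < e" by (simp add: e_def)
    have "0 \<le> Q" by (simp add: Q_def)
    have \<mu>: "0 < \<mu>" "\<mu> \<le> 1" using \<open>0 < e\<close> \<open>0 \<le> Q\<close> by (auto simp: \<mu>_def)
    have "\<mu> \<le> e / (2 * Q + 1)" by (simp add: \<mu>_def)
    then have "\<mu> * (2 * Q + 1) \<le> e" using \<open>0 \<le> Q\<close> by (simp add: pos_le_divide_eq)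
    then have small: "\<mu> * Q < e" using \<mu> \<open>0 \<le> Q\<close> \<open>0 < e\<close>
      by (smt (verit) distrib_left mult.right_neutral mult_nonneg_nonneg mult_2)
    have "\<bar>x + \<mu> * (y - x)\<bar> = \<bar>(1 - \<mu>) * x + \<mu> * y\<bar>" by (simp add: algebra_simps)
    also have "\<dots> \<le> (1 - \<mu>) * \<bar>x\<bar> + \<mu> * \<bar>y\<bar>"
      using \<mu> by (intro order_trans[OF abs_triangle_ineq]) (simp add: abs_mult)
    finally have "s * (\<bar>x + \<mu> * (y - x)\<bar> - \<bar>x\<bar>) \<le> s * (\<mu> * (\<bar>y\<bar> - \<bar>x\<bar>))"
      using \<open>0 < s\<close> by (intro mult_left_mono) (auto simp: algebra_simps)
    moreover have "q * (\<mu> * (y - x))\<^sup>2 \<le> \<mu> * (\<mu> * Q)"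
    proof -
      have "q * (\<mu> * (y - x))\<^sup>2 = (\<mu> * \<mu>) * (q * (y - x)\<^sup>2)"
        by (simp add: power2_eq_square)
      also have "\<dots> \<le> (\<mu> * \<mu>) * Q" using \<mu> by (intro mult_left_mono) (auto simp: Q_def)
      finally show ?thesis by (simp add: mult.assoc)
    qed
    ultimately have "0 \<le> - (\<mu> * (g * (y - x))) + \<mu> * (\<mu> * Q) + s * (\<mu> * (\<bar>y\<bar> - \<bar>x\<bar>))"
      using min[of "x + \<mu> * (y - x)"] by (simp add: mult_ac)
    also have "\<dots> = \<mu> * (\<mu> * Q - e)" by (simp add: e_def algebra_simps)
    finally show False using small \<mu> by (simp add: zero_le_mult_iff)
  qed
  \<comment> \<open>The points \<open>0\<close> and \<open>2 * x\<close> give the two opposite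
    inequalities.\<close>
  show "g * x = s * \<bar>x\<bar>"
    using sub[of 0] sub[of "2 * x"] by (simp add: abs_mult algebra_simps)
  have "s * (\<bar>x + 1\<bar> - \<bar>x\<bar>) \<le> s * 1" "s * (\<bar>x - 1\<bar> - \<bar>x\<bar>) \<le> s * 1"
    using \<open>0 < s\<close> by (auto intro!: mult_left_mono simp del: mult_1_right)
  then show "\<bar>g\<bar> \<le> s" using sub[of "x + 1"] sub[of "x - 1"] by simp
qed

text \<open>The subgradient condition, with the sign condition on the support written as a product.
  Necessity follows by varying one coordinate at a time; for sufficiency, every summand of the
  first-order part of the expansion is nonnegative.\<close>

lemma solutions_iff_optimality:
  assumes A: "A \<in> carrier_mat m N" and f: "f \<in> carrier_vec m" and s: "0 < s"
  shows "u \<in> solutions A f s \<longleftrightarrow> u \<in> carrier_vec N \<and>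
    (\<forall>i<N. \<bar>correlation A f u i\<bar> \<le> s \<and> correlation A f u i * u $ i = s * \<bar>u $ i\<bar>)"
    (is "_ \<longleftrightarrow> _ \<and> ?KKT")
proof (cases "u \<in> carrier_vec N")
  case False
  then show ?thesis using A s by (auto simp: solutions_def is_arg_min_def)
next
  case u: True
  let ?F = "\<lambda>u. 1/2 * (l2_norm (A *\<^sub>v u - f))\<^sup>2 + s * l1_norm u"
  let ?g = "correlation A f u"
  have sol: "u \<in> solutions A f s \<longleftrightarrow> (\<forall>v\<in>carrier_vec N. ?F u \<le> ?F v)"
    using A s u by (auto simp: solutions_def is_arg_min_def not_less)
  have l1: "l1_norm v = (\<Sum>i<N. \<bar>v $ i\<bar>)" if "v \<in> carrier_vec N" for v
    using that by (simp add: l1_norm_def)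
  have F_diff: "?F v - ?F u = (\<Sum>i<N. s * \<bar>v $ i\<bar> - s * \<bar>u $ i\<bar> - ?g i * (v $ i - u $ i))
      + 1/2 * (\<Sum>k<m. (\<Sum>i<N. A $$ (k, i) * (v $ i - u $ i))\<^sup>2)" if "v \<in> carrier_vec N" for v
    unfolding residual_expansion[OF A f u that] l1[OF u] l1[OF that]
    by (simp add: sum_subtractf sum_distrib_left)
  show ?thesis
  proof
    assume "u \<in> solutions A f s"
    then have min: "?F u \<le> ?F v" if "v \<in> carrier_vec N" for v
      using sol that by blast
    have "\<bar>?g i\<bar> \<le> s \<and> ?g i * u $ i = s * \<bar>u $ i\<bar>" if i: "i < N" for i
    proof -
      define q where "q = 1/2 * (\<Sum>k<m. (A $$ (k, i))\<^sup>2)"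
      have "0 \<le> - (?g i * (y - u $ i)) + q * (y - u $ i)\<^sup>2 + s * (\<bar>y\<bar> - \<bar>u $ i\<bar>)" for y
      proof -
        define v where "v = vec N (\<lambda>j. if j = i then y else u $ j)"
        have v: "v \<in> carrier_vec N" by (simp add: v_def)
        have 1: "(\<Sum>j<N. s * \<bar>v $ j\<bar> - s * \<bar>u $ j\<bar> - ?g j * (v $ j - u $ j))
            = s * \<bar>y\<bar> - s * \<bar>u $ i\<bar> - ?g i * (y - u $ i)"
          using i by (subst sum.remove[of _ i]) (auto simp: v_def intro!: sum.neutral)
        have 2: "(\<Sum>j<N. A $$ (k, j) * (v $ j - u $ j)) = A $$ (k, i) * (y - u $ i)" for k
          using i by (subst sum.remove[of _ i]) (auto simp: v_def intro!: sum.neutral)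
        have "0 \<le> ?F v - ?F u" using min[OF v] by simp
        moreover have "1/2 * (\<Sum>k<m. (A $$ (k, i) * (y - u $ i))\<^sup>2) = q * (y - u $ i)\<^sup>2"
          by (simp add: q_def power_mult_distrib sum_distrib_right)
        ultimately show ?thesis
          unfolding F_diff[OF v] 1 2 by (simp add: algebra_simps)
      qed
      from soft_threshold_optimality[OF s this] show ?thesis by blast
    qed
    then show "u \<in> carrier_vec N \<and> ?KKT" using u by blast
  next
    assume KKT: "u \<in> carrier_vec N \<and> ?KKT"
    have "?F u \<le> ?F v" if v: "v \<in> carrier_vec N" for v
    proof -
      have "0 \<le> (\<Sum>i<N. s * \<bar>v $ i\<bar> - s * \<bar>u $ i\<bar> - ?g i * (v $ i - u $ i))"
      proof (rule sum_nonneg)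
        fix i assume "i \<in> {..<N}"
        then have g: "\<bar>?g i\<bar> \<le> s" "?g i * u $ i = s * \<bar>u $ i\<bar>" using KKT by auto
        have "?g i * v $ i \<le> \<bar>?g i\<bar> * \<bar>v $ i\<bar>" by (metis abs_ge_self abs_mult)
        also have "\<dots> \<le> s * \<bar>v $ i\<bar>" using g by (intro mult_right_mono) auto
        finally show "0 \<le> s * \<bar>v $ i\<bar> - s * \<bar>u $ i\<bar> - ?g i * (v $ i - u $ i)"
          using g by (simp add: algebra_simps)
      qed
      then have "0 \<le> ?F v - ?F u"
        unfolding F_diff[OF v] by (simp add: sum_nonneg)
      then show ?thesis by simp
    qed
    then show "u \<in> solutions A f s" using sol by blast
  qed
qed

lemma correlation_add_smult:
  assumes A: "A \<in> carrier_mat m N" and x: "x \<in> carrier_vec N" and d: "d \<in> carrier_vec N"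
  shows "correlation A f (x + h \<cdot>\<^sub>v d) i
    = correlation A f x i - h * (\<Sum>k<m. A $$ (k, i) * (A *\<^sub>v d) $ k)"
proof -
  have "(A *\<^sub>v (x + h \<cdot>\<^sub>v d)) $ k = (A *\<^sub>v x) $ k + h * (A *\<^sub>v d) $ k" if "k < m" for k
    using that x d
    by (simp add: mult_mat_vec_nth[OF A] algebra_simps sum.distrib sum_distrib_left del: index_mult_mat_vec)
  then show ?thesis
    using A by (simp add: correlation_def sum_distrib_left sum_subtractf[symmetric] algebra_simps
        del: index_mult_mat_vec)
qed

lemma eventually_mult_le_at_right_0:
  fixes c K :: real
  assumes "0 < c"
  shows "eventually (\<lambda>h. h * K \<le> c) (at_right 0)"
proof -
  have "((\<lambda>h. h * K) \<longlongrightarrow> 0 * K) (at_right 0)" by (intro tendsto_intros)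
  then have "eventually (\<lambda>h. h * K < c) (at_right 0)"
    using assms by (intro order_tendstoD(2)) auto
  then show ?thesis by eventually_elim simp
qed

text \<open>The optimality conditions are affine in the step length \<open>h\<close> apart from
  absolute values, so for small \<open>h\<close> only the tight ones restrict \<open>d\<close>.
  These restrictions form the KKT system of a least squares problem in the signed columns
  \<open>\<sigma> i * A $$ (k, i)\<close>, which is solvable.\<close>

lemma directions_nonempty:
  assumes A: "A \<in> carrier_mat m N" and f: "f \<in> carrier_vec m" and t: "0 < t"
    and x_sol: "x \<in> solutions A f t"
  shows "directions A f t x \<noteq> {}"
proof -
  define g where "g = correlation A f x"
  have x: "x \<in> carrier_vec N"
    and g: "\<And>i. i < N \<Longrightarrow> \<bar>g i\<bar> \<le> t" "\<And>i. i < N \<Longrightarrow> g i * x $ i = t * \<bar>x $ i\<bar>"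
    using x_sol unfolding solutions_iff_optimality[OF A f t] g_def by auto
  \<comment> \<open>Only coordinates with a tight correlation bound can become or stay nonzero.
    Those in \<open>P\<close> start at zero and may leave it only with the sign of their
    correlation, whence the sign constraint.\<close>
  define E where "E = {i. i < N \<and> \<bar>g i\<bar> = t}"
  define P where "P = {i\<in>E. x $ i = 0}"
  define \<sigma> where "\<sigma> i = sgn (g i)" for i
  have E_sub: "E \<subseteq> {..<N}" and "finite E" by (auto simp: E_def)
  have \<sigma>: "\<sigma> i * \<sigma> i = 1" "g i = t * \<sigma> i" "\<bar>\<sigma> i\<bar> = 1" if "i \<in> E" for i
    using that t by (auto simp: E_def \<sigma>_def sgn_if)
  have x0: "x $ i = 0" if "i < N" "i \<notin> E" for i
  proof (rule ccontr)
    assume "x $ i \<noteq> 0"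
    moreover have "\<bar>g i\<bar> * \<bar>x $ i\<bar> = t * \<bar>x $ i\<bar>"
      using g(2)[OF that(1)] t by (metis abs_mult abs_abs abs_of_pos)
    ultimately show False using that by (simp add: E_def)
  qed
  \<comment> \<open>Along \<open>d\<close> the correlation \<open>g i\<close> changes by \<open>- h * q i\<close> with \<open>q = A\<^sup>T A d\<close>, and it must become
    \<open>\<sigma> i * (t - h)\<close> on the support. This asks for \<open>\<sigma> i * q i = 1\<close> there and \<open>\<sigma> i * q i \<ge> 1\<close> on the
    rest of \<open>E\<close>, which is the optimality condition for approximating \<open>c\<close>.\<close>
  define c where "c k = (f $ k - (A *\<^sub>v x) $ k) / t" for k
  obtain y where y0: "\<And>i. i \<in> P \<Longrightarrow> 0 \<le> y i"
    and yE: "\<And>i. i \<in> E - P \<Longrightarrow>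
      (\<Sum>k\<in>{..<m}. \<sigma> i * A $$ (k, i) * (c k - (\<Sum>l\<in>E. y l * (\<sigma> l * A $$ (k, l))))) = 0"
    and yP: "\<And>i. i \<in> P \<Longrightarrow>
      (\<Sum>k\<in>{..<m}. \<sigma> i * A $$ (k, i) * (c k - (\<Sum>l\<in>E. y l * (\<sigma> l * A $$ (k, l))))) \<le> 0"
    and yP0: "\<And>i. i \<in> P \<Longrightarrow>
      y i * (\<Sum>k\<in>{..<m}. \<sigma> i * A $$ (k, i) * (c k - (\<Sum>l\<in>E. y l * (\<sigma> l * A $$ (k, l))))) = 0"
    by (rule sign_constrained_least_squares[of "{..<m}" E P "\<lambda>i k. \<sigma> i * A $$ (k, i)" c])
      (auto simp: P_def \<open>finite E\<close>)
  define d where "d = vec N (\<lambda>i. if i \<in> E then \<sigma> i * y i else 0)"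
  have d: "d \<in> carrier_vec N" by (simp add: d_def)
  define q where "q i = (\<Sum>k<m. A $$ (k, i) * (A *\<^sub>v d) $ k)" for i
  have Ad: "(A *\<^sub>v d) $ k = (\<Sum>l\<in>E. y l * (\<sigma> l * A $$ (k, l)))" if "k < m" for k
  proof -
    have "(A *\<^sub>v d) $ k = (\<Sum>i<N. if i \<in> E then y i * (\<sigma> i * A $$ (k, i)) else 0)"
      unfolding mult_mat_vec_nth[OF A d that] by (intro sum.cong) (auto simp: d_def)
    also have "\<dots> = (\<Sum>i\<in>E. y i * (\<sigma> i * A $$ (k, i)))"
      using E_sub by (subst sum.inter_restrict[symmetric]) (auto simp: Int_absorb1)
    finally show ?thesis .
  qed
  have grad: "(\<Sum>k\<in>{..<m}. \<sigma> i * A $$ (k, i) * (c k - (\<Sum>l\<in>E. y l * (\<sigma> l * A $$ (k, l))))) = 1 - \<sigma> i * q i"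
    if "i \<in> E" for i
  proof -
    have "(\<Sum>k\<in>{..<m}. \<sigma> i * A $$ (k, i) * (c k - (\<Sum>l\<in>E. y l * (\<sigma> l * A $$ (k, l)))))
        = (\<Sum>k<m. \<sigma> i * (A $$ (k, i) * (f $ k - (A *\<^sub>v x) $ k)) / t - \<sigma> i * (A $$ (k, i) * (A *\<^sub>v d) $ k))"
      by (intro sum.cong) (auto simp: Ad c_def right_diff_distrib simp del: index_mult_mat_vec)
    also have "\<dots> = \<sigma> i * g i / t - \<sigma> i * q i"
      using A by (simp add: g_def q_def correlation_def sum_subtractf sum_distrib_left sum_divide_distrib)
    also have "\<dots> = 1 - \<sigma> i * q i"
      using \<sigma>[OF that] t by (simp add: mult.left_commute)
    finally show ?thesis .
  qed
  have ev: "eventually (\<lambda>h. \<bar>g i - h * q i\<bar> \<le> t - h \<and>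
      (g i - h * q i) * (x $ i + h * d $ i) = (t - h) * \<bar>x $ i + h * d $ i\<bar>) (at_right 0)"
    if i: "i < N" for i
  proof (cases "i \<in> E")
    case False
    then have "x $ i = 0" "d $ i = 0" "0 < t - \<bar>g i\<bar>"
      using i x0 g(1)[OF i] by (auto simp: d_def E_def)
    \<comment> \<open>The strict slack at \<open>t\<close> absorbs both the change of the
      correlation and the decrease of the bound.\<close>
    moreover have "eventually (\<lambda>h. h * (\<bar>q i\<bar> + 1) \<le> t - \<bar>g i\<bar>) (at_right 0)"
      using \<open>0 < t - \<bar>g i\<bar>\<close> by (rule eventually_mult_le_at_right_0)
    then have "eventually (\<lambda>h. \<bar>g i - h * q i\<bar> \<le> t - h) (at_right 0)"
      using eventually_at_right_less[of "0::real"]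
    proof eventually_elim
      case (elim h)
      have "\<bar>g i - h * q i\<bar> \<le> \<bar>g i\<bar> + h * \<bar>q i\<bar>"
        using elim(2) by (intro order_trans[OF abs_triangle_ineq4]) (simp add: abs_mult)
      then show ?case using elim by (simp add: algebra_simps)
    qed
    ultimately show ?thesis by simp
  next
    case True
    note \<sigma> = \<sigma>[OF True]
    have \<sigma>_cancel: "\<sigma> i * a * (\<sigma> i * b) = a * b" for a b
    proof -
      have "\<sigma> i * a * (\<sigma> i * b) = (\<sigma> i * \<sigma> i) * (a * b)" by (simp only: mult_ac)
      then show ?thesis using \<sigma>(1) by simp
    qed
    have \<sigma>_abs: "\<bar>\<sigma> i * a\<bar> = \<bar>a\<bar>" for a using \<sigma>(3) by (simp add: abs_mult)
    have \<sigma>_cases: "\<sigma> i = 1 \<or> \<sigma> i = -1" using \<sigma>(3) by linarith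
    have di: "d $ i = \<sigma> i * y i" using True i by (simp add: d_def)
    show ?thesis
    proof (cases "x $ i = 0")
      case False
      then have "i \<in> E - P" using True by (auto simp: P_def)
      then have "\<sigma> i * q i = 1" using yE grad by auto
      then have q: "q i = \<sigma> i" using \<sigma>_cases by auto
      have xi: "x $ i = \<sigma> i * \<bar>x $ i\<bar>"
      proof -
        have "t * (\<sigma> i * x $ i) = t * \<bar>x $ i\<bar>" using g(2)[OF i] \<sigma>(2) by simp
        then have "\<sigma> i * x $ i = \<bar>x $ i\<bar>" using t by simp
        then show ?thesis using \<sigma>(1) by (metis mult.assoc mult_1_left)
      qed
      have "eventually (\<lambda>h. h * \<bar>y i\<bar> \<le> \<bar>x $ i\<bar>) (at_right 0)"
        using False by (intro eventually_mult_le_at_right_0) auto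
      moreover have "eventually (\<lambda>h. h * 1 \<le> t) (at_right 0)"
        using t by (intro eventually_mult_le_at_right_0)
      ultimately show ?thesis
        using eventually_at_right_less[of "0::real"]
      proof eventually_elim
        case (elim h)
        have "0 \<le> \<bar>x $ i\<bar> + h * y i"
          using elim mult_left_mono[of "- \<bar>y i\<bar>" "y i" h] abs_ge_minus_self[of "y i"] by simp
        moreover have "x $ i + h * d $ i = \<sigma> i * (\<bar>x $ i\<bar> + h * y i)"
          by (subst (1) xi) (simp add: di algebra_simps)
        moreover have "g i - h * q i = \<sigma> i * (t - h)"
          unfolding q \<sigma>(2) by (simp add: algebra_simps)
        ultimately show ?case using elim by (simp add: \<sigma>_abs \<sigma>_cancel)
      qed
    next
      case x_zero: True
      then have "i \<in> P" using True by (simp add: P_def)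
      have q: "1 \<le> \<sigma> i * q i" using yP[OF \<open>i \<in> P\<close>] grad[OF True] by simp
      have comp: "y i = 0 \<or> \<sigma> i * q i = 1" using yP0[OF \<open>i \<in> P\<close>] grad[OF True] by auto
      \<comment> \<open>This is the lower half of the bound on the absolute value; the upper half
        comes from \<open>q\<close>.\<close>
      have "eventually (\<lambda>h. h * (\<sigma> i * q i + 1) \<le> 2 * t) (at_right 0)"
        using t by (intro eventually_mult_le_at_right_0) simp
      moreover have "eventually (\<lambda>h. h * 1 \<le> t) (at_right 0)"
        using t by (intro eventually_mult_le_at_right_0)
      ultimately show ?thesis
        using eventually_at_right_less[of "0::real"]
      proof eventually_elim
        case (elim h)
        have gq: "g i - h * q i = \<sigma> i * (t - h * (\<sigma> i * q i))"
          using \<sigma>_cancel[of 1 "h * q i"] by (simp add: \<sigma>(2) algebra_simps)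
        have "h \<le> h * (\<sigma> i * q i)" using q elim(3) by simp
        then have "\<bar>t - h * (\<sigma> i * q i)\<bar> \<le> t - h"
          using elim(1) unfolding distrib_left by linarith
        then have 1: "\<bar>g i - h * q i\<bar> \<le> t - h" by (simp add: gq \<sigma>_abs)
        have 2: "(g i - h * q i) * (h * d $ i) = (t - h) * \<bar>h * d $ i\<bar>"
        proof (cases "y i = 0")
          case False
          then have "\<sigma> i * q i = 1" using comp by simp
          moreover have "h * d $ i = \<sigma> i * (h * y i)" by (simp add: di)
          ultimately show ?thesis
            using elim y0[OF \<open>i \<in> P\<close>] unfolding gq by (simp only: \<sigma>_abs \<sigma>_cancel) simp
        qed (simp add: di)
        show ?case using 1 2 x_zero by simp
      qed
    qed
  qed
  have "eventually (\<lambda>h. \<forall>i\<in>{..<N}. \<bar>g i - h * q i\<bar> \<le> t - h \<and>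
      (g i - h * q i) * (x $ i + h * d $ i) = (t - h) * \<bar>x $ i + h * d $ i\<bar>) (at_right 0)"
    using ev by (intro eventually_ball_finite) auto
  then obtain b where "0 < b" and b: "\<And>h i. 0 < h \<Longrightarrow> h < b \<Longrightarrow> i < N \<Longrightarrow> \<bar>g i - h * q i\<bar> \<le> t - h \<and>
      (g i - h * q i) * (x $ i + h * d $ i) = (t - h) * \<bar>x $ i + h * d $ i\<bar>"
    unfolding eventually_at_right_field by auto
  \<comment> \<open>Halving keeps \<open>\<delta>\<close> strictly below \<open>t\<close>, so that
    every \<open>s\<close> reached is positive and the optimality conditions apply.\<close>
  define \<delta> where "\<delta> = min b t / 2"
  have \<delta>: "0 < \<delta>" "\<delta> < t" "\<delta> < b" using t \<open>0 < b\<close> by (auto simp: \<delta>_def)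
  have "x + (t - s) \<cdot>\<^sub>v d \<in> solutions A f s" if s: "s \<in> {t - \<delta>..t}" for s
  proof (cases "s = t")
    case True
    moreover have "x + 0 \<cdot>\<^sub>v d = x" by (intro eq_vecI) (use x d in auto)
    ultimately show ?thesis using x_sol by simp
  next
    case False
    then have "0 < s" "0 < t - s" "t - s < b" using s \<delta> by auto
    have "correlation A f (x + (t - s) \<cdot>\<^sub>v d) i = g i - (t - s) * q i" for i
      unfolding correlation_add_smult[OF A x d] g_def q_def ..
    moreover have "(x + (t - s) \<cdot>\<^sub>v d) $ i = x $ i + (t - s) * d $ i" if "i < N" for i
      using that x d by simp
    moreover have "x + (t - s) \<cdot>\<^sub>v d \<in> carrier_vec N" using x d by simp
    ultimately show ?thesis
      unfolding solutions_iff_optimality[OF A f \<open>0 < s\<close>]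
      using b[OF \<open>0 < t - s\<close> \<open>t - s < b\<close>] by simp
  qed
  then have "d \<in> directions A f t x"
    using d \<delta> A by (auto simp: directions_def intro!: exI[of _ \<delta>])
  then show ?thesis by blast
qed

subsection \<open>A lasso problem with nonunique solutions\<close>

definition vec4 :: "real \<Rightarrow> real \<Rightarrow> real \<Rightarrow> real \<Rightarrow> real vec" where
  "vec4 a b c d = vec_of_list [a, b, c, d]"

lemma vec4_nth [simp]:
  "vec4 a b c d $ 0 = a" "vec4 a b c d $ Suc 0 = b" "vec4 a b c d $ 2 = c" "vec4 a b c d $ 3 = d"
  by (simp_all add: vec4_def vec_of_list_index numeral_2_eq_2 numeral_3_eq_3 del: vec_of_list_Cons)

lemma dim_vec4 [simp]: "dim_vec (vec4 a b c d) = 4"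
  by (simp add: vec4_def del: vec_of_list_Cons)

lemma vec4_carrier [simp]: "vec4 a b c d \<in> carrier_vec 4"
  by (rule carrier_vecI) simp

lemma all_less_4: "(\<forall>i<4. P i) \<longleftrightarrow> P 0 \<and> P (Suc 0) \<and> P 2 \<and> P (3::nat)"
  by (auto simp: numeral_eq_Suc less_Suc_eq)

lemma sum_less_4: "(\<Sum>i<4. F i) = F 0 + F (Suc 0) + F 2 + F (3::nat)"
  by (simp add: numeral_eq_Suc)

lemma sum_less_2: "(\<Sum>i<2. F i) = F 0 + F (Suc (0::nat))"
  by (simp add: numeral_eq_Suc)

lemma vec4_eq_iff [simp]:
  "vec4 a b c d = vec4 a' b' c' d' \<longleftrightarrow> a = a' \<and> b = b' \<and> c = c' \<and> d = d'"
  by (metis vec4_nth)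

lemma vec4_eqI:
  assumes "x \<in> carrier_vec 4" "y \<in> carrier_vec 4"
    and "x $ 0 = y $ 0" "x $ Suc 0 = y $ Suc 0" "x $ 2 = y $ 2" "x $ 3 = y $ 3"
  shows "x = y"
proof -
  have "\<forall>i<4. x $ i = y $ i" unfolding all_less_4 using assms(3-6) by blast
  then show ?thesis using assms(1,2) by (intro eq_vecI) auto
qed

lemma vec4_eta: "x \<in> carrier_vec 4 \<Longrightarrow> x = vec4 (x $ 0) (x $ Suc 0) (x $ 2) (x $ 3)"
  by (rule vec4_eqI) simp_all

lemma vec4_set_eqI:
  assumes "S \<subseteq> carrier_vec 4" "T \<subseteq> carrier_vec 4"
    and "\<And>p q r e. vec4 p q r e \<in> S \<longleftrightarrow> vec4 p q r e \<in> T"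
  shows "S = T"
proof -
  have "x \<in> S \<longleftrightarrow> x \<in> T" if "x \<in> carrier_vec 4" for x
    using assms(3) by (subst (1 2) vec4_eta[OF that]) blast
  then show ?thesis using assms(1,2) by blast
qed

lemma vec4_add [simp]: "vec4 a b c d + vec4 a' b' c' d' = vec4 (a + a') (b + b') (c + c') (d + d')"
  by (rule vec4_eqI) simp_all

lemma vec4_smult [simp]: "h \<cdot>\<^sub>v vec4 a b c d = vec4 (h * a) (h * b) (h * c) (h * d)"
  by (rule vec4_eqI) simp_all

lemma zero_vec4: "0\<^sub>v 4 = vec4 0 0 0 0"
  by (rule vec4_eqI) simp_all

section \<open>The concrete problem, its solutions and its possible directions\<close>

definition example_mat :: "real mat" where
  "example_mat = mat_of_rows_list 4 [[1, 1, 1, 0], [0, 0, 0, 1]]"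

definition example_vec :: "real vec" where
  "example_vec = vec_of_list [3, 1]"

lemma example_carrier [simp]: "example_mat \<in> carrier_mat 2 4" "example_vec \<in> carrier_vec 2"
  by (auto simp: example_mat_def example_vec_def mat_of_rows_list_def intro!: carrier_vecI)

lemma example_dims [simp]:
  "dim_row example_mat = 2" "dim_col example_mat = 4" "dim_vec example_vec = 2"
  using example_carrier by (auto simp del: example_carrier)

lemma example_nth [simp]:
  "example_vec $ 0 = 3" "example_vec $ Suc 0 = 1"
  "example_mat $$ (0, 0) = 1" "example_mat $$ (0, Suc 0) = 1" "example_mat $$ (0, 2) = 1"
  "example_mat $$ (0, 3) = 0" "example_mat $$ (Suc 0, 0) = 0" "example_mat $$ (Suc 0, Suc 0) = 0"
  "example_mat $$ (Suc 0, 2) = 0" "example_mat $$ (Suc 0, 3) = 1"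
  by (simp_all add: example_mat_def example_vec_def mat_of_rows_list_def vec_of_list_index
      numeral_2_eq_2 numeral_3_eq_3 del: vec_of_list_Cons)

lemma example_mult:
  "(example_mat *\<^sub>v vec4 a b c d) $ 0 = a + b + c"
  "(example_mat *\<^sub>v vec4 a b c d) $ Suc 0 = d"
  by (simp_all add: mult_mat_vec_nth[OF example_carrier(1) vec4_carrier] sum_less_4
      del: index_mult_mat_vec)

lemma example_transpose_mult:
  assumes "w \<in> carrier_vec 2"
  shows "transpose_mat example_mat *\<^sub>v w = vec4 (w $ 0) (w $ 0) (w $ 0) (w $ Suc 0)"
proof -
  have nth: "(transpose_mat example_mat *\<^sub>v w) $ i
      = example_mat $$ (0, i) * w $ 0 + example_mat $$ (Suc 0, i) * w $ Suc 0" if "i < 4" for i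
  proof -
    have "(transpose_mat example_mat *\<^sub>v w) $ i = (\<Sum>k<2. transpose_mat example_mat $$ (i, k) * w $ k)"
      by (rule mult_mat_vec_nth) (use assms that in simp_all)
    then show ?thesis using that by (simp add: sum_less_2 del: index_mult_mat_vec)
  qed
  show ?thesis
    by (rule vec4_eqI) (auto simp: nth intro!: carrier_vecI simp del: index_mult_mat_vec)
qed

lemma example_correlation:
  "correlation example_mat example_vec (vec4 a b c d) i
    = example_mat $$ (0, i) * (3 - (a + b + c)) + example_mat $$ (Suc 0, i) * (1 - d)"
  by (simp add: correlation_def example_mult sum_less_2 del: index_mult_mat_vec)

text \<open>The first three columns coincide, so only the sum of these coordinates is determined and
  the problem splits into two scalar soft thresholdings. At \<open>t = 0\<close> feasibility forces
  the entries to sum to \<open>4\<close>, and norm \<open>4\<close> means that all of them are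
  nonnegative.\<close>

lemma example_solutions:
  assumes "0 \<le> t"
  shows "vec4 a b c d \<in> solutions example_mat example_vec t \<longleftrightarrow>
    0 \<le> a \<and> 0 \<le> b \<and> 0 \<le> c \<and> a + b + c = max 0 (3 - t) \<and> d = max 0 (1 - t)"
proof (cases "t = 0")
  case False
  then have t: "0 < t" using assms by simp
  define g where "g = 3 - (a + b + c)"
  \<comment> \<open>Trades the products for sign cases, leaving only linear arithmetic.\<close>
  have sgn_iff: "\<bar>\<gamma>\<bar> \<le> t \<and> \<gamma> * x = t * \<bar>x\<bar> \<longleftrightarrow>
      \<bar>\<gamma>\<bar> \<le> t \<and> (0 < x \<longrightarrow> \<gamma> = t) \<and> (x < 0 \<longrightarrow> \<gamma> = - t)" for \<gamma> x :: real
  proof -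
    have "\<gamma> * x = - (t * x) \<longleftrightarrow> \<gamma> = - t" if "x \<noteq> 0"
      using that by (metis minus_mult_left mult_right_cancel)
    then show ?thesis
      by (cases x "0::real" rule: linorder_cases) (auto simp: abs_of_pos abs_of_neg)
  qed
  have "vec4 a b c d \<in> solutions example_mat example_vec t \<longleftrightarrow>
      (\<bar>g\<bar> \<le> t \<and> g * a = t * \<bar>a\<bar>) \<and> (\<bar>g\<bar> \<le> t \<and> g * b = t * \<bar>b\<bar>) \<and> (\<bar>g\<bar> \<le> t \<and> g * c = t * \<bar>c\<bar>)
      \<and> (\<bar>1 - d\<bar> \<le> t \<and> (1 - d) * d = t * \<bar>d\<bar>)"
    by (simp add: solutions_iff_optimality[OF example_carrier t] all_less_4 example_correlation g_def)
  also have "\<dots> \<longleftrightarrow> 0 \<le> a \<and> 0 \<le> b \<and> 0 \<le> c \<and> a + b + c = max 0 (3 - t) \<and> d = max 0 (1 - t)"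
    unfolding sgn_iff unfolding g_def max_def abs_le_iff using t by (smt (verit))
  finally show ?thesis .
next
  case True
  let ?C = "\<lambda>u. u \<in> carrier_vec 4 \<and>
    transpose_mat example_mat *\<^sub>v (example_mat *\<^sub>v u - example_vec) = 0\<^sub>v 4"
  have feasible: "?C (vec4 p q r e) \<longleftrightarrow> p + q + r = 3 \<and> e = 1" for p q r e
    by (subst example_transpose_mult)
      (auto simp: zero_vec4 example_mult intro!: carrier_vecI simp del: index_mult_mat_vec)
  have l1: "l1_norm (vec4 p q r e) = \<bar>p\<bar> + \<bar>q\<bar> + \<bar>r\<bar> + \<bar>e\<bar>" for p q r e
    by (simp add: l1_norm_def sum_less_4)
  have lower: "4 \<le> l1_norm u" if "?C u" for u
  proof -
    have "u \<in> carrier_vec 4" using that by blast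
    then obtain p q r e where u: "u = vec4 p q r e" using vec4_eta by blast
    show ?thesis using that[unfolded u feasible] unfolding u l1 by linarith
  qed
  have "is_arg_min l1_norm ?C u \<longleftrightarrow> ?C u \<and> l1_norm u \<le> 4" for u
  proof
    assume min: "is_arg_min l1_norm ?C u"
    have "?C (vec4 3 0 0 1)" unfolding feasible by simp
    then have "\<not> l1_norm (vec4 3 0 0 1) < l1_norm u"
      using min unfolding is_arg_min_def by blast
    then show "?C u \<and> l1_norm u \<le> 4" using min unfolding is_arg_min_def l1 by auto
  next
    assume "?C u \<and> l1_norm u \<le> 4"
    then show "is_arg_min l1_norm ?C u" unfolding is_arg_min_def using lower by fastforce
  qed
  then have "vec4 a b c d \<in> solutions example_mat example_vec t \<longleftrightarrow>
      ?C (vec4 a b c d) \<and> l1_norm (vec4 a b c d) \<le> 4"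
    using True by (simp add: solutions_def)
  also have "\<dots> \<longleftrightarrow> 0 \<le> a \<and> 0 \<le> b \<and> 0 \<le> c \<and> a + b + c = max 0 (3 - t) \<and> d = max 0 (1 - t)"
    unfolding feasible l1 using True by auto
  finally show ?thesis .
qed

text \<open>A sign constraint matters for arbitrarily short steps only where the coordinate is zero.
  The clock moves as soon as \<open>t \<le> 1\<close>, including \<open>t = 1\<close>, because the
  path is followed downwards.\<close>

lemma example_directions:
  assumes t: "0 < t" "t \<le> 3" and x: "vec4 a b c d \<in> solutions example_mat example_vec t"
  shows "vec4 p q r e \<in> directions example_mat example_vec t (vec4 a b c d) \<longleftrightarrow>
    p + q + r = 1 \<and> e = (if t \<le> 1 then 1 else 0) \<and>
    (a = 0 \<longrightarrow> 0 \<le> p) \<and> (b = 0 \<longrightarrow> 0 \<le> q) \<and> (c = 0 \<longrightarrow> 0 \<le> r)" (is "?L \<longleftrightarrow> ?R")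
proof -
  have abc: "0 \<le> a" "0 \<le> b" "0 \<le> c" "a + b + c = 3 - t" "d = max 0 (1 - t)"
    using x t by (simp_all add: example_solutions)
  have step: "vec4 a b c d + h \<cdot>\<^sub>v vec4 p q r e \<in> solutions example_mat example_vec (t - h) \<longleftrightarrow>
      0 \<le> a + h * p \<and> 0 \<le> b + h * q \<and> 0 \<le> c + h * r \<and> h * (p + q + r) = h \<and> d + h * e = max 0 (1 - (t - h))"
    if "0 \<le> h" "h \<le> t" for h
    using that t abc(4) by (auto simp: example_solutions algebra_simps)
  show ?thesis
  proof
    assume ?L
    then obtain \<delta> where \<delta>: "0 < \<delta>" "\<delta> \<le> t" and
      sol: "\<And>s. s \<in> {t - \<delta>..t} \<Longrightarrow> vec4 a b c d + (t - s) \<cdot>\<^sub>v vec4 p q r e \<in> solutions example_mat example_vec s"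
      unfolding directions_def by blast
    \<comment> \<open>For \<open>t > 1\<close> the test step must not pass \<open>1\<close>, where
      the clock coordinate bends.\<close>
    define h where "h = (if t \<le> 1 then \<delta> else min \<delta> (t - 1))"
    have h: "0 < h" "h \<le> \<delta>" "h \<le> t" using \<delta> by (auto simp: h_def)
    have "0 \<le> a + h * p \<and> 0 \<le> b + h * q \<and> 0 \<le> c + h * r \<and> h * (p + q + r) = h \<and> d + h * e = max 0 (1 - (t - h))"
      using sol[of "t - h"] step[of h] h by simp
    moreover have "max 0 (1 - (t - h)) = d + h * (if t \<le> 1 then 1 else 0)"
      using h abc(5) by (auto simp: h_def)
    ultimately show ?R using h by (auto simp: zero_le_mult_iff)
  next
    assume R: ?R
    have ev: "eventually (\<lambda>h. 0 \<le> v + h * w) (at_right 0)" if "0 \<le> v" "v = 0 \<longrightarrow> 0 \<le> w" for v w :: real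
    proof (cases "v = 0")
      case True
      show ?thesis using eventually_at_right_less[of "0::real"]
        by eventually_elim (use True that in simp)
    next
      case False
      then have "eventually (\<lambda>h. h * (- w) \<le> v) (at_right 0)"
        using that by (intro eventually_mult_le_at_right_0) simp
      then show ?thesis by eventually_elim simp
    qed
    have "eventually (\<lambda>h. h * 1 \<le> (if t \<le> 1 then t else t - 1)) (at_right 0)"
      using t by (intro eventually_mult_le_at_right_0) simp
    with ev[of a p] ev[of b q] ev[of c r]
    have "eventually (\<lambda>h. 0 \<le> a + h * p \<and> 0 \<le> b + h * q \<and> 0 \<le> c + h * r
        \<and> h \<le> (if t \<le> 1 then t else t - 1)) (at_right 0)"
      using R abc by (simp add: eventually_conj_iff)
    then obtain \<beta> where "0 < \<beta>" and \<beta>: "\<And>h. 0 < h \<Longrightarrow> h < \<beta> \<Longrightarrow>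
        0 \<le> a + h * p \<and> 0 \<le> b + h * q \<and> 0 \<le> c + h * r \<and> h \<le> (if t \<le> 1 then t else t - 1)"
      unfolding eventually_at_right_field by auto
    define \<delta> where "\<delta> = min \<beta> t / 2"
    have \<delta>: "0 < \<delta>" "\<delta> \<le> t" "\<delta> < \<beta>" using t \<open>0 < \<beta>\<close> by (auto simp: \<delta>_def)
    have "vec4 a b c d + (t - s) \<cdot>\<^sub>v vec4 p q r e \<in> solutions example_mat example_vec s"
      if "s \<in> {t - \<delta>..t}" for s
    proof (cases "s = t")
      case True
      then show ?thesis using x by simp
    next
      case False
      define h where "h = t - s"
      have h: "0 < h" "h < \<beta>" "h \<le> t" "s = t - h" using that False \<delta> by (auto simp: h_def)
      show ?thesis
        unfolding h_def[symmetric] unfolding h(4)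
        using step[of h] \<beta>[OF h(1,2)] h R abc(5) by (auto split: if_splits)
    qed
    then show ?L unfolding directions_def using \<delta> by auto
  qed
qed

subsection \<open>Piecewise linear paths\<close>

lemma affine_path_on_follow:
  assumes "x \<in> carrier_vec N" "d \<in> carrier_vec N"
    and "\<And>t. t \<in> S \<Longrightarrow> u t = x + (s - t) \<cdot>\<^sub>v d"
  shows "affine_path_on N S u"
  unfolding affine_path_on_def
proof (intro bexI ballI)
  fix t assume "t \<in> S"
  then show "u t = (x + s \<cdot>\<^sub>v d) + t \<cdot>\<^sub>v ((- 1) \<cdot>\<^sub>v d)"
    using assms by (intro eq_vecI) (auto simp: algebra_simps)
qed (use assms in auto)

text \<open>Minimality of \<open>s'\<close> is reduced to failure at each single parameter below it:
  a segment that reaches \<open>r\<close> must in particular be optimal at \<open>r\<close>.\<close>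

lemma meta_stepI:
  assumes "R (directions A f s (u s)) = d" "0 \<le> s'" "s' \<le> s"
    and "\<And>t. s' \<le> t \<Longrightarrow> t \<le> s \<Longrightarrow> u t = u s + (s - t) \<cdot>\<^sub>v d"
    and "\<And>t. s' \<le> t \<Longrightarrow> t \<le> s \<Longrightarrow> u t \<in> solutions A f t"
    and "\<And>t. 0 \<le> t \<Longrightarrow> t < s' \<Longrightarrow> u s + (s - t) \<cdot>\<^sub>v d \<notin> solutions A f t"
  shows "meta_step A f R s s' u"
  unfolding meta_step_def Let_def assms(1)
proof (intro conjI ballI CollectI)
  show "u s + (s - t) \<cdot>\<^sub>v d \<in> solutions A f t" if "t \<in> {s'..s}" for t
    using that assms(4)[of t] assms(5)[of t] by simp
  show "s' \<le> r" if "r \<in> {r. 0 \<le> r \<and> r \<le> s \<and> (\<forall>t\<in>{r..s}. u s + (s - t) \<cdot>\<^sub>v d \<in> solutions A f t)}" for r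
  proof (rule ccontr)
    assume "\<not> s' \<le> r"
    moreover have "0 \<le> r" "r \<in> {r..s}" using that by auto
    moreover from this that have "u s + (s - r) \<cdot>\<^sub>v d \<in> solutions A f r" by blast
    ultimately show False using assms(6)[of r] by simp
  qed
  show "u t = u s + (s - t) \<cdot>\<^sub>v d" if "t \<in> {s'..s}" for t
    using that assms(4)[of t] by simp
qed (fact assms(2,3))+

lemma affine_path_on_continuous:
  assumes "affine_path_on N S u" "i < N"
  shows "continuous_on S (\<lambda>t. u t $ i)"
proof -
  obtain c d where cd: "c \<in> carrier_vec N" "d \<in> carrier_vec N" "\<forall>t\<in>S. u t = c + t \<cdot>\<^sub>v d"
    using assms(1) unfolding affine_path_on_def by blast
  have "continuous_on S (\<lambda>t. c $ i + t * d $ i)" by (intro continuous_intros)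
  moreover have "continuous_on S (\<lambda>t. u t $ i) \<longleftrightarrow> continuous_on S (\<lambda>t. c $ i + t * d $ i)"
    by (rule continuous_on_cong) (use cd assms(2) in auto)
  ultimately show ?thesis by simp
qed

text \<open>Finitely many pieces glue to continuity on each \<open>{b n..}\<close>; as
  \<open>b\<close> tends to 0 these rays cover all positive parameters. Continuity at 0 is the limit
  hypothesis.\<close>

lemma piecewise_linear_imp_continuous:
  assumes "piecewise_linear N u" and u0: "u 0 \<in> carrier_vec N"
    and lim: "\<And>i. i < N \<Longrightarrow> ((\<lambda>t. u t $ i) \<longlongrightarrow> u 0 $ i) (at_right 0)"
  shows "continuous_path N u"
proof -
  obtain b where b: "decseq b" "b \<longlonglongrightarrow> 0"
    and first: "affine_path_on N {b 0..} u" and pieces: "\<And>j. affine_path_on N {b (Suc j)..b j} u"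
    using assms(1) unfolding piecewise_linear_def by blast
  have carrier: "u t \<in> carrier_vec N" if "affine_path_on N S u" "t \<in> S" for S t
    using that unfolding affine_path_on_def by fastforce
  have tails: "(\<forall>t\<ge>b n. u t \<in> carrier_vec N) \<and> (\<forall>i<N. continuous_on {b n..} (\<lambda>t. u t $ i))" for n
  proof (induction n)
    case 0
    then show ?case using first carrier affine_path_on_continuous by auto
  next
    case (Suc n)
    have "b (Suc n) \<le> b n" using b(1) by (simp add: decseq_Suc_iff)
    then have "{b (Suc n)..} = {b (Suc n)..b n} \<union> {b n..}" by auto
    moreover have "\<forall>t\<in>{b (Suc n)..b n} \<union> {b n..}. u t \<in> carrier_vec N"
      using Suc carrier[OF pieces] by auto
    moreover have "continuous_on ({b (Suc n)..b n} \<union> {b n..}) (\<lambda>t. u t $ i)" if "i < N" for i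
      using Suc that affine_path_on_continuous[OF pieces] by (intro continuous_on_closed_Un) auto
    ultimately show ?case by auto
  qed
  have below: "\<exists>n. b n < t" if "0 < t" for t
    using order_tendstoD(2)[OF b(2) that] by (auto simp: eventually_sequentially)
  have "u t \<in> carrier_vec N" if "0 \<le> t" for t
  proof (cases "t = 0")
    case False
    then have "0 < t" using that by simp
    then obtain n where "b n < t" using below by blast
    then show ?thesis using tails[of n] by simp
  qed (use u0 in simp)
  moreover have "continuous_on {0..} (\<lambda>t. u t $ i)" if i: "i < N" for i
    unfolding continuous_on_eq_continuous_within
  proof
    fix t :: real assume "t \<in> {0..}"
    show "continuous (at t within {0..}) (\<lambda>t. u t $ i)"
    proof (cases "t = 0")
      case True
      then show ?thesis
        using lim[OF i] by (simp add: continuous_within at_within_Ici_at_right)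
    next
      case False
      then obtain n where n: "b n < t" using below \<open>t \<in> {0..}\<close> by force
      have "continuous_on {b n<..} (\<lambda>t. u t $ i)"
        using tails[of n] i by (auto intro: continuous_on_subset)
      then have "isCont (\<lambda>t. u t $ i) t"
        using n by (simp add: continuous_on_eq_continuous_at)
      then show ?thesis by (rule continuous_at_imp_continuous_at_within)
    qed
  qed
  ultimately show ?thesis unfolding continuous_path_def by blast
qed

subsection \<open>The bouncing path\<close>

text \<open>The first coordinate of the path on the dyadic interval below \<open>(1/2) ^ k\<close>.
  As \<open>t\<close> decreases, it rises from \<open>0\<close> to \<open>t\<close> for even
  \<open>k\<close> and falls from \<open>t\<close> to \<open>0\<close> for odd
  \<open>k\<close>.\<close>

definition zigzag_piece :: "nat \<Rightarrow> real \<Rightarrow> real" where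
  "zigzag_piece k t = (if even k then (1/2) ^ k - t else 2 * t - (1/2) ^ k)"

definition zigzag :: "real \<Rightarrow> real" where
  "zigzag t = (if t \<le> 0 then 0 else zigzag_piece (LEAST k. (1/2) ^ Suc k \<le> t) t)"

lemma zigzag_eq_piece:
  assumes "(1/2) ^ Suc k \<le> t" "t \<le> (1/2) ^ k"
  shows "zigzag t = zigzag_piece k t"
proof -
  have "0 < t" using assms(1) by (smt (verit) zero_less_divide_1_iff zero_less_power)
  have mono: "(1/2::real) ^ n \<le> (1/2) ^ m" if "m \<le> n" for m n
    using that by (intro power_decreasing) auto
  have Least: "(LEAST k. (1/2) ^ Suc k \<le> t) = n" if "(1/2) ^ Suc n \<le> t" "n = 0 \<or> t < (1/2) ^ n" for n
  proof (rule Least_equality)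
    fix j assume "(1/2) ^ Suc j \<le> t"
    then show "n \<le> j" using that(2) mono[of "Suc j" n] by (cases "n \<le> j") auto
  qed (use that in simp)
  have Z: "zigzag t = zigzag_piece (LEAST k. (1/2) ^ Suc k \<le> t) t"
    unfolding zigzag_def using \<open>0 < t\<close> by (simp only: not_le[symmetric] if_False simp_thms)
  show ?thesis
  proof (cases "k = 0 \<or> t < (1/2) ^ k")
    case True
    show ?thesis unfolding Z Least[OF assms(1) True] ..
  next
    case False
    \<comment> \<open>At the upper endpoint \<open>LEAST\<close> selects the preceding piece, whose
      value there is the same.\<close>
    then obtain n where n: "k = Suc n" "t = (1/2) ^ Suc n" using assms(2) by (cases k) auto
    have L: "(LEAST k. (1/2) ^ Suc k \<le> t) = n"
      by (rule Least) (simp_all add: n(2))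
    show ?thesis unfolding Z L by (simp add: zigzag_piece_def n)
  qed
qed

lemma dyadic_piece_exists:
  fixes t :: real
  assumes "0 < t" "t \<le> 1"
  obtains k where "(1/2) ^ Suc k \<le> t" "t \<le> (1/2) ^ k"
proof -
  define k where "k = (LEAST k. (1/2) ^ Suc k \<le> t)"
  obtain n where "(1/2) ^ n < t" using real_arch_pow_inv[OF assms(1), of "1/2"] by auto
  then have "(1/2) ^ Suc n \<le> t" using assms by simp
  then have 1: "(1/2) ^ Suc k \<le> t" unfolding k_def by (rule LeastI)
  have "t \<le> (1/2) ^ k"
  proof (cases k)
    case (Suc n)
    then have "n < k" by simp
    then have "\<not> (1/2) ^ Suc n \<le> t" unfolding k_def by (rule not_less_Least)
    then show ?thesis using Suc by simp
  qed (use assms in simp)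
  with 1 show ?thesis using that by blast
qed

lemma zigzag_bounds:
  assumes "0 \<le> t" "t \<le> 1"
  shows "0 \<le> zigzag t \<and> zigzag t \<le> t"
proof (cases "t = 0")
  case False
  then obtain k where k: "(1/2) ^ Suc k \<le> t" "t \<le> (1/2) ^ k"
    using assms by (metis dyadic_piece_exists order_le_less)
  then show ?thesis by (simp add: zigzag_eq_piece[OF k] zigzag_piece_def)
qed (simp add: zigzag_def)

text \<open>The first branch reaches \<open>vec4 0 1 1 0\<close> at \<open>t = 1\<close>, on the
  face where the bouncing starts. In the second, \<open>3 - 2 * t\<close> completes the sum of the
  first three entries to \<open>3 - t\<close>.\<close>

definition example_path :: "real \<Rightarrow> real vec" where
  "example_path t = (if 1 \<le> t then vec4 0 (max 0 (3 - t) / 2) (max 0 (3 - t) / 2) 0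
     else vec4 (zigzag t) (t - zigzag t) (3 - 2 * t) (1 - t))"

definition bounce :: "nat \<Rightarrow> real vec" where
  "bounce k = (if even k then vec4 1 (- 2) 2 1 else vec4 (- 2) 1 2 1)"

lemma example_path_zigzag:
  assumes "t \<le> 1"
  shows "example_path t = vec4 (zigzag t) (t - zigzag t) (3 - 2 * t) (1 - t)"
proof (cases "t = 1")
  case True
  have "zigzag 1 = 0" using zigzag_eq_piece[of 0 1] by (simp add: zigzag_piece_def)
  then show ?thesis using True by (simp add: example_path_def)
qed (use assms in \<open>simp add: example_path_def\<close>)

lemma example_path_solutions:
  assumes "0 \<le> t"
  shows "example_path t \<in> solutions example_mat example_vec t"
proof (cases "1 \<le> t")
  case True
  then show ?thesis using assms by (simp add: example_path_def example_solutions)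
next
  case False
  then show ?thesis
    using assms zigzag_bounds[of t] by (simp add: example_path_def example_solutions)
qed

lemma half_power_le_1: "(1/2::real) ^ k \<le> 1"
  by (rule power_le_one) auto

lemma example_path_break:
  "example_path ((1/2) ^ k)
    = (if even k then vec4 0 ((1/2) ^ k) (3 - 2 * (1/2) ^ k) (1 - (1/2) ^ k)
       else vec4 ((1/2) ^ k) 0 (3 - 2 * (1/2) ^ k) (1 - (1/2) ^ k))"
proof -
  have "zigzag ((1/2) ^ k) = zigzag_piece k ((1/2) ^ k)" by (rule zigzag_eq_piece) auto
  then show ?thesis
    using example_path_zigzag[OF half_power_le_1, of k] by (simp add: zigzag_piece_def)
qed

lemma example_path_follow:
  assumes "(1/2) ^ Suc k \<le> t" "t \<le> (1/2) ^ k"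
  shows "example_path t = example_path ((1/2) ^ k) + ((1/2) ^ k - t) \<cdot>\<^sub>v bounce k"
proof -
  have "t \<le> 1" using assms(2) half_power_le_1[of k] by linarith
  then show ?thesis
    unfolding example_path_break example_path_zigzag[OF \<open>t \<le> 1\<close>] zigzag_eq_piece[OF assms]
    by (simp add: zigzag_piece_def bounce_def algebra_simps)
qed

lemma example_path_follow_first:
  assumes "1 \<le> t" "t \<le> 3"
  shows "example_path t = example_path 3 + (3 - t) \<cdot>\<^sub>v vec4 0 (1/2) (1/2) 0"
  using assms by (simp add: example_path_def)

definition breaks :: "nat \<Rightarrow> real" where
  "breaks j = (case j of 0 \<Rightarrow> 3 | Suc k \<Rightarrow> (1/2) ^ k)"

lemma breaks_tendsto: "breaks \<longlonglongrightarrow> 0"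
proof (rule LIMSEQ_imp_Suc)
  show "(\<lambda>k. breaks (Suc k)) \<longlonglongrightarrow> 0"
    by (simp add: breaks_def LIMSEQ_power_zero)
qed

lemma breaks_decseq: "decseq breaks"
  unfolding decseq_Suc_iff
proof
  fix j show "breaks (Suc j) \<le> breaks j" by (cases j) (simp_all add: breaks_def)
qed

section \<open>The choice rule\<close>

definition start_dirs :: "real vec set" where
  "start_dirs = {vec4 p q r 0 | p q r. p + q + r = 1 \<and> 0 \<le> p \<and> 0 \<le> q \<and> 0 \<le> r}"

text \<open>Only the parity of \<open>k\<close> enters, so two prescribed values of the rule settle
  infinitely many bounces. \<open>r\<close> is free since the third coordinate is positive at the
  bounces.\<close>

definition bounce_dirs :: "nat \<Rightarrow> real vec set" where
  "bounce_dirs k = {vec4 p q r 1 | p q r. p + q + r = 1 \<and> (if even k then 0 \<le> p else 0 \<le> q)}"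

definition example_rule :: "real vec set \<Rightarrow> real vec" where
  "example_rule D = (if D = start_dirs then vec4 0 (1/2) (1/2) 0
     else if D = bounce_dirs 0 then bounce 0
     else if D = bounce_dirs 1 then bounce 1
     else SOME d. d \<in> D)"

lemma start_dirs_iff:
  "vec4 p q r e \<in> start_dirs \<longleftrightarrow> e = 0 \<and> p + q + r = 1 \<and> 0 \<le> p \<and> 0 \<le> q \<and> 0 \<le> r"
  by (auto simp: start_dirs_def)

lemma bounce_dirs_iff:
  "vec4 p q r e \<in> bounce_dirs k \<longleftrightarrow> e = 1 \<and> p + q + r = 1 \<and> (if even k then 0 \<le> p else 0 \<le> q)"
  by (auto simp: bounce_dirs_def)

lemma bounce_mem_iff: "bounce k \<in> bounce_dirs l \<longleftrightarrow> even k = even l"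
  by (simp add: bounce_def bounce_dirs_iff)

text \<open>Each prescribed value lies in its own set, so membership holds whatever problem the set
  comes from.\<close>

lemma example_rule_mem: "D \<noteq> {} \<Longrightarrow> example_rule D \<in> D"
  by (simp add: example_rule_def start_dirs_iff bounce_mem_iff some_in_eq)

lemma choice_rule_example_rule: "choice_rule example_rule"
  unfolding choice_rule_def using directions_nonempty example_rule_mem by blast

lemma example_rule_start: "example_rule start_dirs = vec4 0 (1/2) (1/2) 0"
  by (simp add: example_rule_def)

text \<open>The nested conditionals select the intended branch only if the three sets differ; the
  bounce directions themselves separate them.\<close>

lemma example_rule_bounce: "example_rule (bounce_dirs k) = bounce k"
proof -
  have "bounce k \<notin> start_dirs" by (simp add: bounce_def start_dirs_iff)
  then have 1: "bounce_dirs k \<noteq> start_dirs" using bounce_mem_iff[of k k] by auto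
  have 2: "bounce_dirs 1 \<noteq> bounce_dirs 0" using bounce_mem_iff[of 1 1] bounce_mem_iff[of 1 0] by auto
  have "bounce_dirs k = bounce_dirs (if even k then 0 else 1)" "bounce k = bounce (if even k then 0 else 1)"
    by (simp_all add: bounce_dirs_def bounce_def)
  then show ?thesis using 1 2 by (simp add: example_rule_def)
qed

lemma directions_start:
  "directions example_mat example_vec 3 (example_path 3) = start_dirs" (is "?D = _")
proof -
  have "example_path 3 = vec4 0 0 0 0" by (simp add: example_path_def)
  moreover have "vec4 0 0 0 0 \<in> solutions example_mat example_vec 3" by (simp add: example_solutions)
  ultimately have "vec4 p q r e \<in> ?D \<longleftrightarrow> vec4 p q r e \<in> start_dirs" for p q r e
    using example_directions[of 3 0 0 0 0 p q r e] by (auto simp: start_dirs_iff)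
  moreover have "?D \<subseteq> carrier_vec 4" "start_dirs \<subseteq> carrier_vec 4"
    by (auto simp: directions_def start_dirs_def)
  ultimately show ?thesis by (intro vec4_set_eqI)
qed

lemma directions_bounce:
  "directions example_mat example_vec ((1/2) ^ k) (example_path ((1/2) ^ k)) = bounce_dirs k" (is "?D = _")
proof -
  define h where "h = (1/2::real) ^ k"
  have h: "0 < h" "h \<le> 1" using half_power_le_1 by (auto simp: h_def)
  have "vec4 p q r e \<in> ?D \<longleftrightarrow> vec4 p q r e \<in> bounce_dirs k" for p q r e
  proof (cases "even k")
    case True
    then have x: "example_path h = vec4 0 h (3 - 2 * h) (1 - h)"
      using example_path_break[of k] by (simp add: h_def)
    show ?thesis
      using example_directions[of h 0 h "3 - 2 * h" "1 - h" p q r e] example_path_solutions[of h] h True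
      by (auto simp: x h_def[symmetric] bounce_dirs_iff)
  next
    case False
    then have x: "example_path h = vec4 h 0 (3 - 2 * h) (1 - h)"
      using example_path_break[of k] by (simp add: h_def)
    show ?thesis
      using example_directions[of h h 0 "3 - 2 * h" "1 - h" p q r e] example_path_solutions[of h] h False
      by (auto simp: x h_def[symmetric] bounce_dirs_iff)
  qed
  moreover have "?D \<subseteq> carrier_vec 4" "bounce_dirs k \<subseteq> carrier_vec 4"
    by (auto simp: directions_def bounce_dirs_def)
  ultimately show ?thesis by (intro vec4_set_eqI)
qed

section \<open>The run of the meta approach\<close>

lemma example_path_meta_step:
  "meta_step example_mat example_vec example_rule (breaks j) (breaks (Suc j)) example_path"
proof (cases j)
  case 0
  have "meta_step example_mat example_vec example_rule 3 1 example_path"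
  proof (rule meta_stepI)
    show "example_rule (directions example_mat example_vec 3 (example_path 3)) = vec4 0 (1/2) (1/2) 0"
      by (simp add: directions_start example_rule_start)
    \<comment> \<open>The continued segment keeps the clock at \<open>0\<close>, whereas solutions
      below \<open>1\<close> have \<open>1 - t\<close> there.\<close>
    show "example_path 3 + (3 - t) \<cdot>\<^sub>v vec4 0 (1/2) (1/2) 0 \<notin> solutions example_mat example_vec t"
      if "0 \<le> t" "t < 1" for t
      using that by (simp add: example_path_def example_solutions)
    show "example_path t = example_path 3 + (3 - t) \<cdot>\<^sub>v vec4 0 (1/2) (1/2) 0"
      if "1 \<le> t" "t \<le> 3" for t
      using that by (rule example_path_follow_first)
  qed (simp_all add: example_path_solutions)
  then show ?thesis using 0 by (simp add: breaks_def)
next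
  case (Suc k)
  define h where "h = (1/2::real) ^ k"
  have h: "0 < h" "h \<le> 1" "(1/2) ^ Suc k = h / 2" using half_power_le_1 by (auto simp: h_def)
  have "meta_step example_mat example_vec example_rule h (h / 2) example_path"
  proof (rule meta_stepI)
    show "example_rule (directions example_mat example_vec h (example_path h)) = bounce k"
      by (simp add: directions_bounce example_rule_bounce h_def)
    show "example_path t = example_path h + (h - t) \<cdot>\<^sub>v bounce k" if "h / 2 \<le> t" "t \<le> h" for t
      using example_path_follow[of k t] that h by (simp add: h_def)
    \<comment> \<open>The coordinate that starts at \<open>h\<close> with rate \<open>- 2\<close>
      would be \<open>2 * t - h\<close>, hence negative.\<close>
    show "example_path h + (h - t) \<cdot>\<^sub>v bounce k \<notin> solutions example_mat example_vec t"
      if "0 \<le> t" "t < h / 2" for t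
      using that h example_path_break[of k]
      by (cases "even k") (auto simp: h_def[symmetric] bounce_def example_solutions)
  qed (use h in \<open>simp_all add: example_path_solutions\<close>)
  then show ?thesis using Suc h by (simp add: breaks_def h_def)
qed

lemma example_path_piecewise_linear: "piecewise_linear 4 example_path"
  unfolding piecewise_linear_def
proof (intro exI[of _ breaks] conjI allI breaks_decseq breaks_tendsto)
  show "affine_path_on 4 {breaks 0..} example_path"
    by (rule affine_path_on_follow[of "vec4 0 0 0 0" _ "vec4 0 0 0 0" _ _ 0])
      (simp_all add: breaks_def example_path_def)
  fix j
  show "affine_path_on 4 {breaks (Suc j)..breaks j} example_path"
  proof (cases j)
    case 0
    then show ?thesis
      by (intro affine_path_on_follow[of "example_path 3" _ "vec4 0 (1/2) (1/2) 0" _ _ 3] example_path_follow_first)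
        (simp_all add: breaks_def example_path_def)
  next
    case (Suc k)
    then show ?thesis
      by (intro affine_path_on_follow[of "example_path ((1/2) ^ k)" _ "bounce k" _ _ "(1/2) ^ k"] example_path_follow)
        (simp_all add: breaks_def example_path_break bounce_def)
  qed
qed

text \<open>The oscillation dies out because \<open>zigzag\<close> is squeezed between
  \<open>0\<close> and \<open>t\<close>.\<close>

lemma example_path_tendsto:
  assumes "i < 4"
  shows "((\<lambda>t. example_path t $ i) \<longlongrightarrow> example_path 0 $ i) (at_right 0)"
proof -
  have small: "eventually (\<lambda>t. 0 < t \<and> t < 1) (at_right (0::real))"
    unfolding eventually_at_right_field by (rule exI[of _ 1]) simp
  have id: "((\<lambda>t. t) \<longlongrightarrow> 0) (at_right (0::real))" by (rule tendsto_ident_at)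
  have z: "(zigzag \<longlongrightarrow> 0) (at_right 0)"
  proof (rule tendsto_sandwich[OF _ _ tendsto_const id])
    show "eventually (\<lambda>t. 0 \<le> zigzag t) (at_right 0)" "eventually (\<lambda>t. zigzag t \<le> t) (at_right 0)"
      using small by (eventually_elim; use zigzag_bounds in force)+
  qed
  have z0: "zigzag 0 = 0" by (simp add: zigzag_def)
  define p where "p t = vec4 (zigzag t) (t - zigzag t) (3 - 2 * t) (1 - t)" for t
  have "((\<lambda>t. t - zigzag t) \<longlongrightarrow> 0 - 0) (at_right 0)" "((\<lambda>t. 3 - 2 * t) \<longlongrightarrow> 3 - 2 * 0) (at_right (0::real))"
    "((\<lambda>t. 1 - t) \<longlongrightarrow> 1 - 0) (at_right (0::real))"
    by (intro tendsto_intros z id)+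
  then have "\<forall>i<4. ((\<lambda>t. p t $ i) \<longlongrightarrow> example_path 0 $ i) (at_right 0)"
    unfolding all_less_4 using z z0 by (simp add: p_def example_path_def)
  then have "((\<lambda>t. p t $ i) \<longlongrightarrow> example_path 0 $ i) (at_right 0)" using assms by blast
  moreover have "eventually (\<lambda>t. p t $ i = example_path t $ i) (at_right 0)"
    using small by eventually_elim (simp add: p_def example_path_zigzag)
  ultimately show ?thesis by (rule Lim_transform_eventually)
qed

lemma example_path_meta_path: "meta_path example_mat example_vec example_rule example_path"
proof -
  have "transpose_mat example_mat *\<^sub>v example_vec = vec4 3 3 3 1"
    by (simp add: example_transpose_mult)
  moreover have "{..<4} = {0, Suc 0, 2, 3}" by auto
  ultimately have "breaks 0 = linf_norm (transpose_mat example_mat *\<^sub>v example_vec)"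
    by (simp add: linf_norm_def breaks_def)
  moreover have "\<forall>t\<ge>breaks 0. example_path t = 0\<^sub>v (dim_col example_mat)"
    by (simp add: breaks_def example_path_def zero_vec4)
  moreover have "breaks j > 0" for j by (cases j) (simp_all add: breaks_def)
  moreover have "example_path 0 \<in> carrier_vec (dim_col example_mat)" by (simp add: example_path_def)
  ultimately show ?thesis
    unfolding meta_path_def using breaks_tendsto example_path_meta_step example_path_tendsto
    by (intro exI[of _ breaks]) simp
qed

lemma example_path_kink: "kink 4 example_path ((1/2) ^ Suc k)"
  unfolding kink_def
proof (intro bexI exI conjI ballI)
  define h where "h = (1/2::real) ^ Suc k"
  have h: "0 < h" "(1/2) ^ k = 2 * h" by (auto simp: h_def)
  show "bounce k \<noteq> bounce (Suc k)" by (simp add: bounce_def)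
  \<comment> \<open>The window is the whole piece below the kink and half of the longer piece above
    it.\<close>
  show "0 < (1/2::real) ^ Suc k / 2" "(1/2::real) ^ Suc k / 2 \<le> (1/2) ^ Suc k" by simp_all
  show "example_path s = example_path ((1/2) ^ Suc k) + ((1/2) ^ Suc k - s) \<cdot>\<^sub>v bounce k"
    if "s \<in> {(1/2) ^ Suc k..(1/2) ^ Suc k + (1/2) ^ Suc k / 2}" for s
  proof -
    have s: "h \<le> s" "s \<le> 2 * h" using that h by (auto simp: h_def[symmetric])
    note follow = example_path_follow[of k, folded h_def, unfolded h(2)]
    \<comment> \<open>The upper piece is based at its right end \<open>2 * h\<close>; evaluating it
      at \<open>h\<close> moves the base to the kink.\<close>
    have "example_path h = example_path (2 * h) + h \<cdot>\<^sub>v bounce k"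
      using follow[of h] h(1) by simp
    moreover have "example_path s = example_path (2 * h) + (2 * h - s) \<cdot>\<^sub>v bounce k"
      using s by (rule follow)
    moreover have "example_path (2 * h) \<in> carrier_vec 4" "bounce k \<in> carrier_vec 4"
      by (auto simp: example_path_def bounce_def)
    ultimately show ?thesis
      unfolding h_def[symmetric] by (intro eq_vecI) (auto simp: algebra_simps)
  qed
  show "example_path s = example_path ((1/2) ^ Suc k) + ((1/2) ^ Suc k - s) \<cdot>\<^sub>v bounce (Suc k)"
    if "s \<in> {(1/2) ^ Suc k - (1/2) ^ Suc k / 2..(1/2) ^ Suc k}" for s
    using that by (intro example_path_follow) auto
qed (simp_all add: bounce_def)

lemma infinite_kinks: "infinite {t. kink 4 example_path t}"
proof
  assume "finite {t. kink 4 example_path t}"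
  moreover have "range (\<lambda>k. (1/2) ^ Suc k) \<subseteq> {t. kink 4 example_path t}"
    using example_path_kink by blast
  ultimately have "finite (range (\<lambda>k. (1/2::real) ^ Suc k))" by (rule rev_finite_subset)
  moreover have "inj (\<lambda>k. (1/2::real) ^ Suc k)"
    by (rule injI) (simp add: power_inject_exp')
  ultimately show False using finite_imageD infinite_UNIV_nat by blast
qed

theorem proposition4p1:
  shows "\<exists>R. choice_rule R \<and>
           (\<exists>m N A f u. A \<in> carrier_mat m N \<and> f \<in> carrier_vec m \<and>
              meta_path A f R u \<and> solution_path A f u \<and>
              piecewise_linear N u \<and> continuous_path N u \<and>
              infinite {t. kink N u t})"
proof -
  have "continuous_path 4 example_path"
    by (rule piecewise_linear_imp_continuous)
      (simp_all add: example_path_piecewise_linear example_path_tendsto, simp add: example_path_def)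
  moreover have "solution_path example_mat example_vec example_path"
    by (simp add: solution_path_def example_path_solutions)
  ultimately show ?thesis
    using choice_rule_example_rule example_path_meta_path example_path_piecewise_linear infinite_kinks
      example_carrier by blast
qed

end
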